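(* For every integer $n\geq 4$, $fsmp(PG_n)=fmp(PG_n)=n-1$.
   Context: The pancake graph $PG_n$ has as vertices all permutations $a_1a_2\ldots a_n$ of $\{1,\dots,n\}$; two vertices $a_1\ldots a_n$ and $b_1\ldots b_n$ are adjacent iff for some $2\leq k\leq n$, $b_i=a_{k+1-i}$ for $1\leq i\leq k$ and $b_i=a_i$ for $k+1\leq i\leq n$. A fractional perfect matching of $G$ is $g:E(G)\to[0,1]$ with $\sum_{e\ni v}g(e)=1$ for all $v$. $fmp(G)$ (resp. $fsmp(G)$) is the minimum size of a set $F\subseteq E(G)$ (resp. $F\subseteq V(G)\cup E(G)$) whose deletion (vertices with incident edges, and edges) leaves a graph with no fractional perfect matching. *)

theory Defs
  imports Complex_Main "HOL-Combinatorics.Permutations"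
begin

text \<open>All graphs here are finite and simple; an edge is the two-element set of its ends.\<close>

record 'a ugraph =
  verts :: "'a set"
  edges :: "'a set set"

text \<open>
  The value of \<open>g\<close> outside \<open>edges G\<close> is irrelevant. The graph without vertices has a
  (vacuous) fractional perfect matching.
\<close>

definition fractional_perfect_matching :: "'a ugraph \<Rightarrow> ('a set \<Rightarrow> real) \<Rightarrow> bool" where
  "fractional_perfect_matching G g \<longleftrightarrow>
     (\<forall>e\<in>edges G. 0 \<le> g e \<and> g e \<le> 1) \<and>
     (\<forall>v\<in>verts G. (\<Sum>e | e \<in> edges G \<and> v \<in> e. g e) = 1)"

text \<open>
  A set of vertices and edges is a subset of the disjoint union \<open>verts G <+> edges G\<close>:
  \<open>Inl v\<close> is a vertex and \<open>Inr e\<close> an edge. A deleted vertex takes its incident edges with it.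
\<close>

definition delete :: "'a ugraph \<Rightarrow> ('a + 'a set) set \<Rightarrow> 'a ugraph" where
  "delete G F =
     \<lparr>verts = {v \<in> verts G. Inl v \<notin> F},
      edges = {e \<in> edges G. Inr e \<notin> F \<and> (\<forall>v\<in>e. Inl v \<notin> F)}\<rparr>"

text \<open>
  The infima below are minima over sets of natural numbers, nonempty for every finite simple
  graph with a vertex (delete all edges); for the graph without vertices they are \<open>Inf {} = 0\<close>.
\<close>

definition fmp :: "'a ugraph \<Rightarrow> nat" where
  "fmp G = Inf {card F | F. F \<subseteq> edges G \<and>
     \<not> (\<exists>g. fractional_perfect_matching (delete G (Inr ` F)) g)}"

definition fsmp :: "'a ugraph \<Rightarrow> nat" where
  "fsmp G = Inf {card F | F. F \<subseteq> verts G <+> edges G \<and>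
     \<not> (\<exists>g. fractional_perfect_matching (delete G F) g)}"

text \<open>A permutation \<open>a\<^sub>1 \<dots> a\<^sub>n\<close> is the function \<open>a\<close> permuting \<open>{1..n}\<close> with \<open>a i = a\<^sub>i\<close>.\<close>

definition pancake_adj :: "nat \<Rightarrow> (nat \<Rightarrow> nat) \<Rightarrow> (nat \<Rightarrow> nat) \<Rightarrow> bool" where
  "pancake_adj n a b \<longleftrightarrow>
     (\<exists>k\<in>{2..n}. (\<forall>i\<in>{1..k}. b i = a (k + 1 - i)) \<and> (\<forall>i\<in>{k+1..n}. b i = a i))"

definition pancake_graph :: "nat \<Rightarrow> (nat \<Rightarrow> nat) ugraph" where
  "pancake_graph n =
     \<lparr>verts = {a. a permutes {1..n}},
      edges = {{a, b} | a b. a permutes {1..n} \<and> b permutes {1..n} \<and> pancake_adj n a b}\<rparr>"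

end

theory Submission
  imports Defs
begin

text \<open>
  Deleting the \<open>n - 1\<close> edges at a vertex isolates it. For the lower bound, induct on \<open>n\<close>:
  \<open>PG\<^sub>n\<^sub>+\<^sub>1\<close> consists of \<open>n + 1\<close> copies of \<open>PG\<^sub>n\<close>, one for each last symbol, and of the perfect
  matching given by the reversal of the whole string. If no copy contains all \<open>n - 1\<close> faults, the
  fractional perfect matchings of the copies together form one of the graph. If only edges are
  deleted, the flips of some length survive as a perfect matching. Otherwise all faults lie in one
  copy and one of them is a vertex \<open>x\<close>. Restore \<open>x\<close>, take a fractional perfect matching of the copy
  and discard the edges at \<open>x\<close> again. The weight now missing at the neighbours of \<open>x\<close> is carried
  by their cross edges. These lead to distinct copies, and there a convex combination of a
  fractional perfect matching of the copy and one avoiding the end of the cross edge has the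
  required vertex sums. The base case \<open>n = 4\<close> is reduced by symmetry to the deletion of the identity
  together with one further vertex or edge, and settled by explicit matchings.
\<close>

section \<open>Prefix reversals, copies and edges\<close>

definition prefix_rev :: "nat \<Rightarrow> nat \<Rightarrow> nat" where
  "prefix_rev k i = (if 1 \<le> i \<and> i \<le> k then k + 1 - i else i)"

lemma prefix_rev_prefix_rev [simp]: "prefix_rev k (prefix_rev k i) = i"
  by (auto simp: prefix_rev_def)

lemma comp_prefix_rev_cancel [simp]: "a \<circ> prefix_rev k \<circ> prefix_rev k = a"
  by (simp add: fun_eq_iff)

lemma prefix_rev_one: "1 \<le> k \<Longrightarrow> prefix_rev k 1 = k"
  and prefix_rev_last: "1 \<le> k \<Longrightarrow> prefix_rev k k = 1"
  and prefix_rev_above: "k < i \<Longrightarrow> prefix_rev k i = i"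
  by (auto simp: prefix_rev_def)

lemma prefix_rev_permutes: "k \<le> n \<Longrightarrow> prefix_rev k permutes {1..n}"
  by (rule bij_imp_permutes)
    (auto intro!: bij_betwI[where g = "prefix_rev k"] simp: prefix_rev_def)

text \<open>The copy of the pancake graph that permutes the first \<open>n\<close> symbols of the string \<open>p\<close>.\<close>

definition coset :: "nat \<Rightarrow> (nat \<Rightarrow> nat) \<Rightarrow> (nat \<Rightarrow> nat) set" where
  "coset n p = {p \<circ> b |b. b permutes {1..n}}"

definition flip_edges :: "nat \<Rightarrow> (nat \<Rightarrow> nat) set \<Rightarrow> (nat \<Rightarrow> nat) set set" where
  "flip_edges n C = {{a, a \<circ> prefix_rev k} |a k. a \<in> C \<and> k \<in> {2..n}}"

lemma finite_coset: "finite (coset n p)"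
proof -
  have "coset n p = (\<circ>) p ` {b. b permutes {1..n}}"
    by (auto simp: coset_def)
  then show ?thesis
    by (simp add: finite_permutations)
qed

lemma finite_flip_edges: "finite C \<Longrightarrow> finite (flip_edges n C)"
  unfolding flip_edges_def by (rule finite_image_set2) auto

lemma self_in_coset: "p \<in> coset n p"
  unfolding coset_def using permutes_id[of "{1..n}"] by (metis (mono_tags, lifting) comp_id mem_Collect_eq)

lemma inj_coset: "a \<in> coset n p \<Longrightarrow> inj p \<Longrightarrow> inj a"
  by (auto simp: coset_def intro: inj_compose permutes_inj)

lemma coset_flip: "a \<in> coset n p \<Longrightarrow> k \<le> n \<Longrightarrow> a \<circ> prefix_rev k \<in> coset n p"
  unfolding coset_def using permutes_compose[OF prefix_rev_permutes] by (auto simp: comp_assoc)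

text \<open>These are left cosets of the group of permutations of \<open>{1..n}\<close>, so every
  member can serve as base string. This allows recentring a copy at a chosen vertex.\<close>

lemma coset_eq:
  assumes "a \<in> coset n p"
  shows "coset n a = coset n p"
proof -
  obtain b where b: "b permutes {1..n}" "a = p \<circ> b"
    using assms by (auto simp: coset_def)
  then have p: "p = a \<circ> inv b"
    by (simp add: comp_assoc permutes_inv_o)
  show ?thesis
  proof
    show "coset n a \<subseteq> coset n p"
      unfolding coset_def b(2) using b(1) by (auto simp: comp_assoc intro: permutes_compose)
    show "coset n p \<subseteq> coset n a"
    proof
      fix x assume "x \<in> coset n p"
      then obtain c where "c permutes {1..n}" "x = p \<circ> c"
        by (auto simp: coset_def)
      moreover from this have "x = a \<circ> (inv b \<circ> c)"
        by (subst (asm) p) (simp add: comp_assoc)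
      moreover have "inv b \<circ> c permutes {1..n}"
        using calculation(1) b(1) by (simp add: permutes_compose permutes_inv)
      ultimately show "x \<in> coset n a"
        unfolding coset_def by blast
    qed
  qed
qed

text \<open>The splitting behind the induction. Since \<open>a\<close> is injective,
  \<open>a \<circ> q\<close> ends in the same symbol as \<open>a\<close> only if \<open>q\<close>
  fixes \<open>Suc n\<close>, that is, if \<open>q\<close> permutes the first \<open>n\<close>
  positions.\<close>

lemma coset_last_symbol:
  assumes "inj p" "a \<in> coset (Suc n) p"
  shows "coset n a = {b \<in> coset (Suc n) p. b (Suc n) = a (Suc n)}"
proof (intro equalityI subsetI)
  fix b assume "b \<in> coset n a"
  then obtain q where q: "q permutes {1..n}" "b = a \<circ> q"
    by (auto simp: coset_def)
  moreover have "q permutes {1..Suc n}"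
    by (rule permutes_subset[OF q(1)]) auto
  then have "b \<in> coset (Suc n) a"
    using q by (auto simp: coset_def)
  moreover have "q (Suc n) = Suc n"
    using q(1) by (simp add: permutes_def)
  ultimately show "b \<in> {b \<in> coset (Suc n) p. b (Suc n) = a (Suc n)}"
    using coset_eq[OF assms(2)] by simp
next
  fix b assume b: "b \<in> {b \<in> coset (Suc n) p. b (Suc n) = a (Suc n)}"
  then obtain q where q: "q permutes {1..Suc n}" "b = a \<circ> q"
    using coset_eq[OF assms(2)] by (auto simp: coset_def)
  have "q (Suc n) = Suc n"
    using b q(2) inj_coset[OF assms(2,1)] by (simp add: inj_eq)
  then have "q permutes {1..n}"
    using permutes_superset[OF q(1)] by (metis Diff_iff atLeastAtMost_iff le_Suc_eq)
  then show "b \<in> coset n a"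
    using q(2) by (auto simp: coset_def)
qed

lemma flip_inject:
  assumes "inj a" "1 \<le> j" "1 \<le> k" "a \<circ> prefix_rev j = a \<circ> prefix_rev k"
  shows "j = k"
proof -
  have "a j = a k"
    using fun_cong[OF assms(4), of 1] assms(2,3) prefix_rev_one by simp
  then show ?thesis
    using assms(1) by (simp add: inj_eq)
qed

text \<open>A flip of length \<open>k\<close> brings the \<open>k\<close>-th entry to the front, so
  an edge reveals its length, whichever end it is read from. The lengths thus colour the edges
  properly, and edges at a vertex can be counted by length.\<close>

lemma flip_edge_eq:
  assumes "inj a" "1 \<le> j" "1 \<le> k" "{a, a \<circ> prefix_rev j} = {b, b \<circ> prefix_rev k}"
  shows "j = k \<and> (b = a \<or> b = a \<circ> prefix_rev k)"
proof -
  consider "a = b" "a \<circ> prefix_rev j = b \<circ> prefix_rev k"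
    | "a = b \<circ> prefix_rev k" "a \<circ> prefix_rev j = b"
    using assms(4) by (auto simp: doubleton_eq_iff)
  then show ?thesis
  proof cases
    case 1
    then show ?thesis using flip_inject[OF assms(1-3)] by simp
  next
    case 2
    then have "a \<circ> prefix_rev j = a \<circ> prefix_rev k" by simp
    then show ?thesis using flip_inject[OF assms(1-3)] 2 by simp
  qed
qed

section \<open>Weightings and tolerance of faults\<close>

text \<open>
  A fractional perfect matching of the graph on \<open>C\<close> with the vertices \<open>X\<close> and the edges \<open>Y\<close>
  deleted: \<open>w a k\<close> is the weight of the edge from \<open>a\<close> to its flip of length \<open>k\<close>.
\<close>

definition weighting ::
  "nat \<Rightarrow> (nat \<Rightarrow> nat) set \<Rightarrow> (nat \<Rightarrow> nat) set \<Rightarrow> (nat \<Rightarrow> nat) set set \<Rightarrow>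
   ((nat \<Rightarrow> nat) \<Rightarrow> nat \<Rightarrow> real) \<Rightarrow> bool" where
  "weighting n C X Y w \<longleftrightarrow>
     (\<forall>a\<in>C. \<forall>k\<in>{2..n}. 0 \<le> w a k \<and> w (a \<circ> prefix_rev k) k = w a k \<and>
        (a \<in> X \<or> {a, a \<circ> prefix_rev k} \<in> Y \<longrightarrow> w a k = 0)) \<and>
     (\<forall>a\<in>C - X. (\<Sum>k=2..n. w a k) = 1)"

text \<open>The bound \<open>n - 2\<close> is one below the claimed value \<open>n - 1\<close>.
  Stating it for a set of strings rather than for the whole graph lets the induction hypothesis
  speak about the copies inside a larger graph.\<close>

definition robust :: "nat \<Rightarrow> (nat \<Rightarrow> nat) set \<Rightarrow> bool" where
  "robust n C \<longleftrightarrow> (\<forall>X Y. X \<subseteq> C \<longrightarrow> Y \<subseteq> flip_edges n C \<longrightarrow> card X + card Y \<le> n - 2 \<longrightarrow>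
     (\<exists>w. weighting n C X Y w))"

lemma weightingI:
  assumes "\<And>a k. a \<in> C \<Longrightarrow> 2 \<le> k \<Longrightarrow> k \<le> n \<Longrightarrow> 0 \<le> w a k"
    and "\<And>a k. a \<in> C \<Longrightarrow> 2 \<le> k \<Longrightarrow> k \<le> n \<Longrightarrow> w (a \<circ> prefix_rev k) k = w a k"
    and "\<And>a k. a \<in> C \<Longrightarrow> 2 \<le> k \<Longrightarrow> k \<le> n \<Longrightarrow> a \<in> X \<Longrightarrow> w a k = 0"
    and "\<And>a k. a \<in> C \<Longrightarrow> 2 \<le> k \<Longrightarrow> k \<le> n \<Longrightarrow> {a, a \<circ> prefix_rev k} \<in> Y \<Longrightarrow> w a k = 0"
    and "\<And>a. a \<in> C \<Longrightarrow> a \<notin> X \<Longrightarrow> (\<Sum>k=2..n. w a k) = 1"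
  shows "weighting n C X Y w"
  unfolding weighting_def using assms by simp

lemma weightingD:
  assumes "weighting n C X Y w" "a \<in> C"
  shows "2 \<le> k \<Longrightarrow> k \<le> n \<Longrightarrow> 0 \<le> w a k"
    and "2 \<le> k \<Longrightarrow> k \<le> n \<Longrightarrow> w (a \<circ> prefix_rev k) k = w a k"
    and "2 \<le> k \<Longrightarrow> k \<le> n \<Longrightarrow> a \<in> X \<Longrightarrow> w a k = 0"
    and "2 \<le> k \<Longrightarrow> k \<le> n \<Longrightarrow> {a, a \<circ> prefix_rev k} \<in> Y \<Longrightarrow> w a k = 0"
    and "a \<notin> X \<Longrightarrow> (\<Sum>k=2..n. w a k) = 1"
  using assms unfolding weighting_def by auto

text \<open>The flips of a fixed length form a perfect matching, and fewer than \<open>n - 1\<close> edges miss one of them.\<close>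

lemma weighting_without_vertices:
  assumes "inj p" "finite Y" "card Y < n - 1"
  shows "\<exists>w. weighting n (coset n p) {} Y w"
proof -
  have "\<exists>k\<in>{2..n}. \<forall>a\<in>coset n p. {a, a \<circ> prefix_rev k} \<notin> Y"
  proof (rule ccontr)
    assume "\<not> ?thesis"
    then obtain f where f: "\<And>k. k \<in> {2..n} \<Longrightarrow> f k \<in> coset n p"
      "\<And>k. k \<in> {2..n} \<Longrightarrow> {f k, f k \<circ> prefix_rev k} \<in> Y"
      by metis
    have "inj_on (\<lambda>k. {f k, f k \<circ> prefix_rev k}) {2..n}"
    proof (rule inj_onI)
      fix j k assume jk: "j \<in> {2..n}" "k \<in> {2..n}"
        and eq: "{f j, f j \<circ> prefix_rev j} = {f k, f k \<circ> prefix_rev k}"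
      show "j = k"
        using flip_edge_eq[OF inj_coset[OF f(1)[OF jk(1)] assms(1)] _ _ eq] jk by simp
    qed
    moreover have "(\<lambda>k. {f k, f k \<circ> prefix_rev k}) ` {2..n} \<subseteq> Y"
      using f(2) by auto
    ultimately have "card {2..n} \<le> card Y"
      using assms(2) card_inj_on_le by blast
    then show False
      using assms(3) by simp
  qed
  then obtain m where m: "m \<in> {2..n}" "\<And>a. a \<in> coset n p \<Longrightarrow> {a, a \<circ> prefix_rev m} \<notin> Y"
    by blast
  have "weighting n (coset n p) {} Y (\<lambda>a k. if k = m then 1 else 0)"
    by (rule weightingI) (use m in \<open>auto split: if_splits\<close>)
  then show ?thesis by blast
qed

section \<open>The induction step\<close>

lemma weighting_Suc:
  assumes "\<And>a k. a \<in> C \<Longrightarrow> 2 \<le> k \<Longrightarrow> k \<le> n \<Longrightarrow> 0 \<le> u a k"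
    and "\<And>a k. a \<in> C \<Longrightarrow> 2 \<le> k \<Longrightarrow> k \<le> n \<Longrightarrow> u (a \<circ> prefix_rev k) k = u a k"
    and "\<And>a k. a \<in> C \<Longrightarrow> 2 \<le> k \<Longrightarrow> k \<le> n \<Longrightarrow> a \<in> X \<Longrightarrow> u a k = 0"
    and "\<And>a k. a \<in> C \<Longrightarrow> 2 \<le> k \<Longrightarrow> k \<le> n \<Longrightarrow> {a, a \<circ> prefix_rev k} \<in> Y \<Longrightarrow> u a k = 0"
    and "\<And>a. a \<in> C \<Longrightarrow> 0 \<le> d a"
    and "\<And>a. a \<in> C \<Longrightarrow> d (a \<circ> prefix_rev (Suc n)) = d a"
    and "\<And>a. a \<in> C \<Longrightarrow> a \<in> X \<Longrightarrow> d a = 0"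
    and "\<And>a. a \<in> C \<Longrightarrow> {a, a \<circ> prefix_rev (Suc n)} \<in> Y \<Longrightarrow> d a = 0"
    and "\<And>a. a \<in> C \<Longrightarrow> a \<notin> X \<Longrightarrow> (\<Sum>k=2..n. u a k) + d a = 1"
    and "1 \<le> n"
  shows "weighting (Suc n) C X Y (\<lambda>a k. if k = Suc n then d a else u a k)"
proof (rule weightingI)
  fix a assume "a \<in> C" "a \<notin> X"
  moreover have "(\<Sum>k=2..n. if k = Suc n then d a else u a k) = (\<Sum>k=2..n. u a k)"
    by (rule sum.cong) auto
  ultimately show "(\<Sum>k=2..Suc n. if k = Suc n then d a else u a k) = 1"
    using assms(9)[of a] assms(10) by simp
qed (use assms(1-8) in \<open>auto simp: le_Suc_eq\<close>)

lemma robust_Suc: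
  fixes p :: "nat \<Rightarrow> nat"
  assumes n: "3 \<le> n"
    and IH: "\<And>q. inj q \<Longrightarrow> robust n (coset n q)"
    and p: "inj p"
  shows "robust (Suc n) (coset (Suc n) p)"
  unfolding robust_def
proof (intro allI impI)
  fix X Y
  assume X: "X \<subseteq> coset (Suc n) p" and Y: "Y \<subseteq> flip_edges (Suc n) (coset (Suc n) p)"
    and card: "card X + card Y \<le> Suc n - 2"
  define C where "C = coset (Suc n) p"
  define B where "B s = {a \<in> C. a (Suc n) = s}" for s
  have finX: "finite X" and finY: "finite Y"
    using X Y finite_coset finite_flip_edges finite_subset by metis+
  have inj: "inj a" if "a \<in> C" for a
    using inj_coset that p unfolding C_def by blast
  have B_coset: "coset n a = B (a (Suc n))" if "a \<in> C" for a
    using coset_last_symbol[OF p] that unfolding C_def B_def by blast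
  have flip_C: "a \<circ> prefix_rev k \<in> C" if "a \<in> C" "k \<le> Suc n" for a k
    using coset_flip that unfolding C_def by blast
  have flip_last: "(a \<circ> prefix_rev k) (Suc n) = a (Suc n)" if "k \<le> n" for a :: "nat \<Rightarrow> nat" and k
    using that by (simp add: prefix_rev_above)
  have flip_B: "a \<circ> prefix_rev k \<in> B s \<longleftrightarrow> a \<in> B s" if "a \<in> C" "k \<le> n" for a k s
    using that flip_C[OF that(1), of k] flip_last[OF that(2), of a] by (simp add: B_def)
  have cross: "(a \<circ> prefix_rev (Suc n)) (Suc n) = a 1" for a :: "nat \<Rightarrow> nat"
    by (simp add: prefix_rev_last)
  have cross_neq: "a 1 \<noteq> a (Suc n)" if "a \<in> C" for a
    using inj[OF that] n by (simp add: inj_eq)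
  have block: "\<exists>w. weighting n (B (a (Suc n))) X' Y' w"
    if "a \<in> C" "X' \<subseteq> B (a (Suc n))" "Y' \<subseteq> flip_edges n (B (a (Suc n)))" "card X' + card Y' \<le> n - 2"
    for a X' Y'
    using IH[OF inj[OF that(1)]] that unfolding B_coset[OF that(1)] robust_def by blast
  show "\<exists>w. weighting (Suc n) (coset (Suc n) p) X Y w"
  proof (cases "\<forall>a\<in>C. card (X \<inter> B (a (Suc n))) + card (Y \<inter> flip_edges n (B (a (Suc n)))) \<le> n - 2")
    case True
    then have "\<exists>w. a \<in> C \<longrightarrow>
        weighting n (B (a (Suc n))) (X \<inter> B (a (Suc n))) (Y \<inter> flip_edges n (B (a (Suc n)))) w" for a
      using block by blast
    \<comment> \<open>A copy is determined by its last symbol, so one weight is chosen per symbol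
      \<open>s\<close>. For an \<open>s\<close> that ends no string of \<open>C\<close> the claim is
      vacuous.\<close>
    then have "\<exists>w. \<forall>a\<in>C. a (Suc n) = s \<longrightarrow>
        weighting n (B s) (X \<inter> B s) (Y \<inter> flip_edges n (B s)) w" for s
      by metis
    then obtain W where W: "\<And>a. a \<in> C \<Longrightarrow> weighting n (B (a (Suc n))) (X \<inter> B (a (Suc n)))
        (Y \<inter> flip_edges n (B (a (Suc n)))) (W (a (Suc n)))"
      by metis
    have B_self: "a \<in> B (a (Suc n))" if "a \<in> C" for a
      using that by (simp add: B_def)
    have "weighting (Suc n) C X Y (\<lambda>a k. if k = Suc n then 0 else W (a (Suc n)) a k)"
    proof (rule weighting_Suc)
      fix a k assume ak: "a \<in> C" "2 \<le> k" "k \<le> n"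
      note D = weightingD[OF W[OF ak(1)] B_self[OF ak(1)]]
      show "0 \<le> W (a (Suc n)) a k"
        using D(1) ak by blast
      show "W ((a \<circ> prefix_rev k) (Suc n)) (a \<circ> prefix_rev k) k = W (a (Suc n)) a k"
        unfolding flip_last[OF ak(3)] using D(2) ak by blast
      show "W (a (Suc n)) a k = 0" if "a \<in> X"
        using D(3) ak that B_self by blast
      show "W (a (Suc n)) a k = 0" if "{a, a \<circ> prefix_rev k} \<in> Y"
      proof -
        have "{a, a \<circ> prefix_rev k} \<in> flip_edges n (B (a (Suc n)))"
          using B_self[OF ak(1)] ak(2,3) unfolding flip_edges_def by auto
        then show ?thesis
          using D(4) ak that by blast
      qed
    next
      fix a assume "a \<in> C" "a \<notin> X"
      then show "(\<Sum>k=2..n. W (a (Suc n)) a k) + 0 = 1"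
        using weightingD(5)[OF W[of a] B_self[of a]] by simp
    qed (use n in auto)
    then show ?thesis
      unfolding C_def by blast
  next
    case False
    then obtain a0 where a0: "a0 \<in> C"
      "n - 1 \<le> card (X \<inter> B (a0 (Suc n))) + card (Y \<inter> flip_edges n (B (a0 (Suc n))))"
      by fastforce
    define s0 where "s0 = a0 (Suc n)"
    have le: "card (X \<inter> B s0) \<le> card X" "card (Y \<inter> flip_edges n (B s0)) \<le> card Y"
      using finX finY by (auto intro: card_mono)
    \<comment> \<open>One copy holds at least \<open>n - 1\<close> of the at most
      \<open>n - 1\<close> faults, hence all of them.\<close>
    then have "card X \<le> card (X \<inter> B s0)" "card Y \<le> card (Y \<inter> flip_edges n (B s0))"
      and cardXY: "card X + card Y = n - 1"
      using a0(2) card n unfolding s0_def by linarith+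
    then have "X \<inter> B s0 = X" "Y \<inter> flip_edges n (B s0) = Y"
      using card_seteq[OF finX Int_lower1] card_seteq[OF finY Int_lower1] by blast+
    then have X0: "X \<subseteq> B s0" and Y0: "Y \<subseteq> flip_edges n (B s0)"
      by blast+
    show ?thesis
    proof (cases "X = {}")
      case True
      then show ?thesis
        using weighting_without_vertices[OF p finY, of "Suc n"] cardXY n by simp
    next
      case False
      then obtain x where x: "x \<in> X" by blast
      have xB: "x \<in> B s0" and xC: "x \<in> C"
        using x X0 by (auto simp: B_def)
      have "card (X - {x}) + card Y \<le> n - 2"
        using card_Diff_singleton[OF x] card_gt_0_iff[of X] False finX cardXY by linarith
      then obtain g where g: "weighting n (B s0) (X - {x}) Y g"
        using block[OF a0(1), of "X - {x}" Y] X0 Y0 unfolding s0_def by blast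
      text \<open>
        Deleting \<open>x\<close> as well leaves the neighbours of \<open>x\<close> in its copy with a deficit \<open>d\<close>, which their
        cross edges supply. These cross edges lead to distinct copies.
      \<close>
      define g' where "g' a k = (if a = x \<or> a \<circ> prefix_rev k = x then 0 else g a k)" for a k
      define d where "d a = (if a \<in> B s0 - X then 1 - (\<Sum>k=2..n. g' a k) else 0)" for a
      have B0C: "a \<in> C" if "a \<in> B s" for a s
        using that by (simp add: B_def)
      have g'_le: "0 \<le> g' a k \<and> g' a k \<le> g a k" if "a \<in> B s0" "2 \<le> k" "k \<le> n" for a k
        using weightingD(1)[OF g that] by (simp add: g'_def)
      have g'_sym: "g' (a \<circ> prefix_rev k) k = g' a k" if "a \<in> B s0" "2 \<le> k" "k \<le> n" for a k
        using weightingD(2)[OF g that] by (auto simp: g'_def)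
      have d_bounds: "0 \<le> d a" "d a \<le> 1" for a
      proof -
        have "0 \<le> (\<Sum>k=2..n. g' a k) \<and> (\<Sum>k=2..n. g' a k) \<le> 1" if "a \<in> B s0" "a \<notin> X"
        proof
          show "0 \<le> (\<Sum>k=2..n. g' a k)"
            by (rule sum_nonneg) (use g'_le that in auto)
          have "(\<Sum>k=2..n. g' a k) \<le> (\<Sum>k=2..n. g a k)"
            by (rule sum_mono) (use g'_le that in auto)
          then show "(\<Sum>k=2..n. g' a k) \<le> 1"
            using weightingD(5)[OF g that(1)] that by simp
        qed
        then show "0 \<le> d a" "d a \<le> 1"
          by (auto simp: d_def)
      qed
      have d_neighbour: "\<exists>k\<in>{2..n}. a = x \<circ> prefix_rev k" if "d a \<noteq> 0" for a
      proof (rule ccontr)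
        assume contra: "\<not> ?thesis"
        have a: "a \<in> B s0" "a \<notin> X"
          using that by (auto simp: d_def split: if_splits)
        have "g' a k = g a k" if "k \<in> {2..n}" for k
        proof -
          have "a \<noteq> x"
            using a x by blast
          moreover have "a \<circ> prefix_rev k \<noteq> x"
            using contra that comp_prefix_rev_cancel[of a k] by metis
          ultimately show ?thesis
            by (simp add: g'_def)
        qed
        then have "(\<Sum>k=2..n. g' a k) = (\<Sum>k=2..n. g a k)"
          by simp
        also have "\<dots> = 1"
          using weightingD(5)[OF g a(1)] a by simp
        finally show False
          using that by (simp add: d_def split: if_splits)
      qed
      \<comment> \<open>The last symbol of \<open>y\<close> is the first symbol of its reversal, a
        flip of \<open>x\<close> of length \<open>j\<close>, and hence equals \<open>x j\<close>.
        Different neighbours of \<open>x\<close> therefore have cross edges into different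
        copies.\<close>
      have d_unique: "y = z"
        if yz: "d (y \<circ> prefix_rev (Suc n)) \<noteq> 0" "d (z \<circ> prefix_rev (Suc n)) \<noteq> 0"
          "y (Suc n) = z (Suc n)" for y z
      proof -
        obtain j k where jk: "j \<in> {2..n}" "k \<in> {2..n}"
          "y \<circ> prefix_rev (Suc n) = x \<circ> prefix_rev j" "z \<circ> prefix_rev (Suc n) = x \<circ> prefix_rev k"
          using d_neighbour[OF yz(1)] d_neighbour[OF yz(2)] by blast
        have "y (Suc n) = x j" "z (Suc n) = x k"
          using fun_cong[OF jk(3), of 1] fun_cong[OF jk(4), of 1] jk(1,2)
          by (simp_all add: prefix_rev_one[simplified])
        then have "j = k"
          using yz(3) inj[OF xC] by (simp add: inj_eq)
        then show ?thesis
          using jk(3,4) by (metis comp_prefix_rev_cancel)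
      qed
      \<comment> \<open>In each copy, the sum at a vertex has to leave room for exactly the weight
        that its cross edge brings in. By \<open>d_unique\<close> this concerns at most one vertex
        \<open>y\<close> of the copy.\<close>
      have other: "\<exists>w. (\<forall>a\<in>B (b (Suc n)). (\<forall>k\<in>{2..n}. 0 \<le> w a k \<and> w (a \<circ> prefix_rev k) k = w a k) \<and>
          (\<Sum>k=2..n. w a k) + d (a \<circ> prefix_rev (Suc n)) = 1)" if b: "b \<in> C" for b
      proof -
        define s where "s = b (Suc n)"
        obtain u0 where u0: "weighting n (B s) {} {} u0"
          using block[OF b, of "{}" "{}"] unfolding s_def by auto
        show ?thesis
        proof (cases "\<exists>y\<in>B s. d (y \<circ> prefix_rev (Suc n)) \<noteq> 0")
          case False
          then show ?thesis
            using weightingD(1,2,5)[OF u0] unfolding s_def[symmetric] by (intro exI[of _ u0]) auto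
        next
          case True
          then obtain y where y: "y \<in> B s" "d (y \<circ> prefix_rev (Suc n)) \<noteq> 0"
            by blast
          \<comment> \<open>Here \<open>3 \<le> n\<close> is needed: a copy has to tolerate the
            deletion of the single vertex \<open>y\<close>.\<close>
          have "1 \<le> n - 2"
            using n by simp
          then obtain u1 where u1: "weighting n (B s) {y} {} u1"
            using block[OF b, of "{y}" "{}"] y(1) \<open>1 \<le> n - 2\<close> unfolding s_def by auto
          define e where "e = d (y \<circ> prefix_rev (Suc n))"
          \<comment> \<open>Both \<open>u0\<close> and \<open>u1\<close> have sum 1 away from
            \<open>y\<close>, and so has the mixture. At \<open>y\<close> the sums are 1 and 0, so
            the mixture has sum \<open>1 - e\<close>.\<close>
          define w where "w a k = (1 - e) * u0 a k + e * u1 a k" for a k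
          have "0 \<le> w a k \<and> w (a \<circ> prefix_rev k) k = w a k" if "a \<in> B s" "k \<in> {2..n}" for a k
            using weightingD(1,2)[OF u0 that(1), of k] weightingD(1,2)[OF u1 that(1), of k] that(2)
              d_bounds[of "y \<circ> prefix_rev (Suc n)"]
            by (simp add: w_def e_def)
          moreover have "(\<Sum>k=2..n. w a k) + d (a \<circ> prefix_rev (Suc n)) = 1" if a: "a \<in> B s" for a
          proof -
            have sum_w: "(\<Sum>k=2..n. w a k) = (1 - e) * (\<Sum>k=2..n. u0 a k) + e * (\<Sum>k=2..n. u1 a k)"
              by (simp add: w_def sum.distrib sum_distrib_left)
            show ?thesis
            proof (cases "a = y")
              case True
              have "(\<Sum>k=2..n. u1 a k) = 0"
                using weightingD(3)[OF u1 a] True by (intro sum.neutral) auto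
              then show ?thesis
                using sum_w weightingD(5)[OF u0 a] True by (simp add: e_def)
            next
              case False
              then have "d (a \<circ> prefix_rev (Suc n)) = 0"
                using d_unique[of a y] y a by (auto simp: B_def)
              then show ?thesis
                using sum_w weightingD(5)[OF u0 a] weightingD(5)[OF u1 a] False by simp
            qed
          qed
          ultimately show ?thesis
            unfolding s_def[symmetric] by blast
        qed
      qed
      then have "\<exists>w. \<forall>b\<in>C. b (Suc n) = s \<longrightarrow>
          (\<forall>a\<in>B s. (\<forall>k\<in>{2..n}. 0 \<le> w a k \<and> w (a \<circ> prefix_rev k) k = w a k) \<and>
            (\<Sum>k=2..n. w a k) + d (a \<circ> prefix_rev (Suc n)) = (1::real))" for s
        by metis
      then obtain W where W': "\<forall>s. \<forall>b\<in>C. b (Suc n) = s \<longrightarrow>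
          (\<forall>a\<in>B s. (\<forall>k\<in>{2..n}. 0 \<le> W s a k \<and> W s (a \<circ> prefix_rev k) k = W s a k) \<and>
            (\<Sum>k=2..n. W s a k) + d (a \<circ> prefix_rev (Suc n)) = (1::real))"
        by metis
      have W: "0 \<le> W (a (Suc n)) a k" "W (a (Suc n)) (a \<circ> prefix_rev k) k = W (a (Suc n)) a k"
        if "a \<in> C" "2 \<le> k" "k \<le> n" for a k
        using W' that by (auto simp: B_def)
      have W_sum: "(\<Sum>k=2..n. W (a (Suc n)) a k) + d (a \<circ> prefix_rev (Suc n)) = 1" if "a \<in> C" for a
        using W' that by (auto simp: B_def)
      have d_other: "d a = 0" if "a \<notin> B s0" for a
        using that by (simp add: d_def)
      \<comment> \<open>The full reversal moves the first symbol to the end, and it differs from the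
        old last symbol.\<close>
      have cross_out: "a \<circ> prefix_rev (Suc n) \<notin> B s0" if "a \<in> B s0" for a
        using that cross[of a] cross_neq[of a] by (auto simp: B_def)
      have Y_in: "a \<in> B s0 \<and> a \<circ> prefix_rev k \<in> B s0" if e: "{a, a \<circ> prefix_rev k} \<in> Y" for a k
      proof -
        obtain b j where bj: "b \<in> B s0" "j \<in> {2..n}" "{a, a \<circ> prefix_rev k} = {b, b \<circ> prefix_rev j}"
          using subsetD[OF Y0 e] unfolding flip_edges_def by blast
        have "b \<circ> prefix_rev j \<in> B s0"
          using bj flip_B B0C by simp
        then show ?thesis
          using bj(1,3) by (metis doubleton_eq_iff)
      qed
      \<comment> \<open>The sum of two terms makes the cross weight symmetric in the ends of the
        edge. At most one term is nonzero, because \<open>d\<close> vanishes outside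
        \<open>B s0\<close> and a cross edge has at most one end there.\<close>
      have "weighting (Suc n) C X Y (\<lambda>a k. if k = Suc n then d a + d (a \<circ> prefix_rev (Suc n))
          else if a \<in> B s0 then g' a k else W (a (Suc n)) a k)"
      proof (rule weighting_Suc)
        fix a k assume ak: "a \<in> C" "2 \<le> k" "k \<le> n"
        show "0 \<le> (if a \<in> B s0 then g' a k else W (a (Suc n)) a k)"
          using g'_le W ak by simp
        show "(if a \<circ> prefix_rev k \<in> B s0 then g' (a \<circ> prefix_rev k) k
            else W ((a \<circ> prefix_rev k) (Suc n)) (a \<circ> prefix_rev k) k) =
          (if a \<in> B s0 then g' a k else W (a (Suc n)) a k)"
          unfolding flip_last[OF ak(3)] using flip_B[OF ak(1,3)] g'_sym W ak by simp
        show "(if a \<in> B s0 then g' a k else W (a (Suc n)) a k) = 0" if "a \<in> X"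
          using that X0 weightingD(3)[OF g _ ak(2,3), of a] by (auto simp: g'_def)
        show "(if a \<in> B s0 then g' a k else W (a (Suc n)) a k) = 0" if "{a, a \<circ> prefix_rev k} \<in> Y"
          using that Y_in[OF that] weightingD(4)[OF g _ ak(2,3), of a] by (auto simp: g'_def)
      next
        fix a assume a: "a \<in> C"
        show "0 \<le> d a + d (a \<circ> prefix_rev (Suc n))"
          using d_bounds by simp
        show "d (a \<circ> prefix_rev (Suc n)) + d (a \<circ> prefix_rev (Suc n) \<circ> prefix_rev (Suc n)) =
          d a + d (a \<circ> prefix_rev (Suc n))"
          by simp
        show "d a + d (a \<circ> prefix_rev (Suc n)) = 0" if "a \<in> X"
          using that X0 cross_out[of a] d_other by (auto simp: d_def)
        show "d a + d (a \<circ> prefix_rev (Suc n)) = 0" if "{a, a \<circ> prefix_rev (Suc n)} \<in> Y"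
          using Y_in[OF that] cross_out by blast
        show "(\<Sum>k=2..n. if a \<in> B s0 then g' a k else W (a (Suc n)) a k) +
            (d a + d (a \<circ> prefix_rev (Suc n))) = 1" if "a \<notin> X"
        proof (cases "a \<in> B s0")
          case True
          then show ?thesis
            using that cross_out[OF True] d_other by (simp add: d_def)
        next
          case False
          then show ?thesis
            using W_sum[OF a] d_other by simp
        qed
      qed (use n in auto)
      then show ?thesis
        unfolding C_def by blast
    qed
  qed
qed

section \<open>The base case \<open>n = 4\<close>\<close>

definition list_flip :: "nat \<Rightarrow> nat list \<Rightarrow> nat list" where
  "list_flip k xs = rev (take k xs) @ drop k xs"

text \<open>The tables are read off in this order. The identity comes first, so
  \<open>tl strings4\<close> lists the possible second deleted vertices.\<close>

definition strings4 :: "nat list list" where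
  "strings4 =
  [[1, 2, 3, 4], [1, 2, 4, 3], [1, 3, 2, 4], [1, 3, 4, 2], [1, 4, 2, 3], [1, 4, 3, 2],
   [2, 1, 3, 4], [2, 1, 4, 3], [2, 3, 1, 4], [2, 3, 4, 1], [2, 4, 1, 3], [2, 4, 3, 1],
   [3, 1, 2, 4], [3, 1, 4, 2], [3, 2, 1, 4], [3, 2, 4, 1], [3, 4, 1, 2], [3, 4, 2, 1],
   [4, 1, 2, 3], [4, 1, 3, 2], [4, 2, 1, 3], [4, 2, 3, 1], [4, 3, 1, 2], [4, 3, 2, 1]]"

text \<open>
  A table lists, in the order of \<open>strings4\<close>, flip lengths that move the remaining strings along a
  permutation of them (\<open>0\<close> at a deleted string). Half the number of times this permutation uses an
  edge, in either direction, is a fractional perfect matching.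
\<close>

definition string_weight :: "nat list \<Rightarrow> nat list \<Rightarrow> nat \<Rightarrow> nat" where
  "string_weight t x k =
     (if map_of (zip strings4 t) x = Some k then 1 else 0) +
     (if map_of (zip strings4 t) (list_flip k x) = Some k then 1 else 0)"

text \<open>Weights are doubled to stay in the natural numbers: 2 stands for a vertex sum of 1. The
  value 0 at a deleted string says that no edge at it carries weight.\<close>

definition perfect_table :: "nat list list \<Rightarrow> nat list \<Rightarrow> bool" where
  "perfect_table D t \<longleftrightarrow> list_all (\<lambda>x.
     string_weight t x 2 + string_weight t x 3 + string_weight t x 4 = (if x \<in> set D then 0 else 2)) strings4"

text \<open>The identity and the \<open>i\<close>-th further string are deleted in the \<open>i\<close>-th table.\<close>

definition vertex_tables :: "nat list list" where
  "vertex_tables =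
  [[0, 0, 3, 4, 4, 2, 4, 4, 2, 4, 2, 3, 3, 4, 4, 3, 4, 2, 2, 3, 4, 4, 3, 3],
   [0, 2, 0, 2, 2, 4, 3, 2, 4, 3, 2, 2, 3, 2, 2, 4, 2, 3, 4, 2, 2, 3, 2, 2],
   [0, 3, 4, 0, 4, 3, 4, 3, 4, 3, 4, 3, 2, 4, 2, 4, 4, 4, 4, 2, 4, 2, 4, 3],
   [0, 3, 3, 3, 0, 3, 3, 2, 4, 2, 4, 2, 2, 2, 4, 2, 4, 2, 4, 2, 2, 2, 4, 2],
   [0, 3, 4, 3, 4, 0, 3, 4, 4, 3, 4, 3, 3, 4, 4, 4, 4, 3, 4, 4, 3, 4, 3, 3],
   [0, 3, 2, 3, 4, 3, 0, 2, 2, 4, 4, 3, 2, 3, 4, 3, 4, 2, 2, 4, 2, 2, 3, 3],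
   [0, 3, 2, 2, 4, 3, 4, 0, 4, 3, 3, 2, 3, 4, 4, 2, 3, 3, 4, 4, 3, 4, 3, 2],
   [0, 4, 2, 2, 4, 2, 4, 4, 0, 3, 3, 4, 4, 4, 4, 3, 4, 3, 4, 2, 3, 4, 4, 3],
   [0, 3, 4, 4, 4, 2, 4, 2, 2, 0, 4, 4, 3, 4, 4, 4, 3, 2, 3, 4, 4, 4, 2, 2],
   [0, 3, 2, 4, 2, 2, 4, 4, 2, 4, 0, 3, 2, 2, 2, 3, 4, 2, 2, 3, 3, 3, 4, 3],
   [0, 2, 4, 2, 4, 2, 4, 4, 2, 3, 2, 0, 3, 4, 4, 2, 3, 4, 2, 4, 4, 4, 3, 2],
   [0, 4, 4, 4, 4, 3, 4, 3, 4, 4, 2, 4, 0, 4, 2, 4, 4, 2, 4, 3, 3, 4, 4, 3],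
   [0, 4, 3, 4, 3, 2, 3, 4, 2, 2, 3, 4, 4, 0, 4, 3, 2, 2, 3, 2, 3, 4, 4, 3],
   [0, 3, 3, 4, 2, 4, 3, 4, 3, 3, 4, 2, 3, 3, 0, 4, 2, 4, 3, 2, 2, 3, 3, 2],
   [0, 3, 4, 3, 3, 3, 3, 3, 2, 3, 3, 3, 3, 3, 2, 0, 3, 3, 3, 3, 3, 4, 3, 3],
   [0, 4, 3, 4, 4, 2, 4, 2, 2, 4, 3, 4, 4, 4, 4, 3, 0, 2, 3, 3, 4, 4, 4, 3],
   [0, 3, 3, 2, 4, 2, 4, 2, 3, 3, 3, 4, 3, 4, 4, 3, 4, 0, 4, 2, 4, 2, 2, 3],
   [0, 3, 4, 4, 3, 4, 4, 2, 2, 2, 4, 4, 3, 3, 2, 4, 4, 2, 0, 2, 4, 4, 2, 2],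
   [0, 3, 4, 3, 2, 4, 3, 4, 2, 2, 4, 4, 2, 4, 2, 4, 3, 2, 3, 0, 3, 2, 4, 2],
   [0, 4, 2, 4, 2, 2, 4, 4, 2, 3, 3, 4, 2, 4, 2, 3, 3, 4, 3, 3, 0, 3, 4, 3],
   [0, 3, 3, 4, 4, 4, 4, 4, 4, 3, 4, 4, 2, 4, 4, 4, 4, 4, 4, 2, 4, 0, 4, 2],
   [0, 2, 3, 4, 4, 2, 3, 4, 2, 3, 2, 2, 3, 2, 4, 2, 3, 4, 2, 3, 2, 4, 0, 2],
   [0, 2, 4, 2, 2, 3, 3, 2, 4, 2, 3, 3, 4, 2, 2, 2, 2, 3, 4, 2, 2, 4, 4, 0]]"

text \<open>Only the identity is deleted; no edge is used by all three tables.\<close>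

definition edge_tables :: "nat list list" where
  "edge_tables =
  [[0, 2, 4, 2, 4, 4, 3, 2, 3, 4, 2, 4, 3, 3, 4, 4, 2, 2, 4, 4, 2, 2, 2, 2],
   [0, 3, 2, 4, 2, 2, 4, 4, 2, 3, 4, 3, 2, 2, 2, 3, 4, 4, 2, 2, 2, 3, 4, 3],
   [0, 3, 3, 3, 3, 4, 3, 4, 3, 2, 4, 2, 3, 3, 4, 4, 4, 2, 4, 2, 3, 2, 3, 2]]"

lemma perfect_vertex_tables:
  "list_all2 (\<lambda>u t. perfect_table [[1, 2, 3, 4], u] t) (tl strings4) vertex_tables"
  by code_simp

lemma perfect_edge_tables:
  "list_all (perfect_table [[1, 2, 3, 4]]) edge_tables"
  by code_simp

lemma edge_tables_avoid:
  "list_all (\<lambda>x. list_all (\<lambda>k. list_ex (\<lambda>t. string_weight t x k = 0) edge_tables) [2, 3, 4]) strings4"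
  by code_simp

text \<open>Relabelling the symbols by \<open>inv v\<close> turns \<open>v\<close> into the
  identity. Only the first four positions vary within \<open>coset 4 v\<close>, and on that coset
  \<open>inv v\<close> undoes \<open>v\<close> as soon as \<open>v\<close> is injective.\<close>

definition rel_string :: "(nat \<Rightarrow> nat) \<Rightarrow> (nat \<Rightarrow> nat) \<Rightarrow> nat list" where
  "rel_string v a = map (inv v \<circ> a) [1..<5]"

text \<open>Reduces membership in the list to distinctness and a range condition on the four
  entries, avoiding a case split over permutations.\<close>

lemma strings4_eq: "strings4 = filter distinct (product_lists (replicate 4 [1, 2, 3, 4]))"
  by code_simp

lemma permutation_string4:
  assumes "b permutes {1..4}"
  shows "map b [1..<5] \<in> set strings4"
proof -
  have "list_all2 (\<lambda>x ys. x \<in> set ys) (map b [1..<5]) (replicate 4 [1, 2, 3, 4])"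
    unfolding list_all2_conv_all_nth
  proof (intro conjI allI impI)
    fix i assume "i < length (map b [1..<5])"
    then have "b (1 + i) \<in> {1..4}" "i < 4"
      using permutes_in_image[OF assms] by auto
    then show "map b [1..<5] ! i \<in> set (replicate 4 [1, 2, 3, 4] ! i)"
      by auto
  qed simp
  moreover have "distinct (map b [1..<5])"
    by (simp add: distinct_map permutes_inj_on[OF assms])
  ultimately show ?thesis
    unfolding strings4_eq by (simp only: set_filter product_lists_set mem_Collect_eq)
qed

lemma string_coset:
  assumes "inj v" "a \<in> coset 4 v"
  shows "rel_string v a \<in> set strings4"
proof -
  obtain b where b: "b permutes {1..4}" "a = v \<circ> b"
    using assms(2) by (auto simp: coset_def)
  then have "rel_string v a = map b [1..<5]"
    using assms(1) by (simp add: rel_string_def comp_def)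
  then show ?thesis
    using permutation_string4[OF b(1)] by simp
qed

lemma string_inject:
  assumes "inj v" "a \<in> coset 4 v" "c \<in> coset 4 v" "rel_string v a = rel_string v c"
  shows "a = c"
proof -
  obtain b b' where b: "b permutes {1..4}" "a = v \<circ> b" "b' permutes {1..4}" "c = v \<circ> b'"
    using assms(2,3) by (auto simp: coset_def)
  have "b i = b' i" if "i \<in> {1..4}" for i
  proof -
    have "i \<in> set [1..<5]"
      using that by auto
    then have "(inv v \<circ> a) i = (inv v \<circ> c) i"
      using assms(4) unfolding rel_string_def map_eq_conv by blast
    then show ?thesis
      using b assms(1) by simp
  qed
  moreover have "b i = b' i" if "i \<notin> {1..4}" for i
    using b(1,3) that by (simp add: permutes_not_in)
  ultimately have "b = b'"
    by blast
  then show ?thesis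
    using b by simp
qed

lemma string_self: "inj v \<Longrightarrow> rel_string v v = [1, 2, 3, 4]"
  by (simp add: rel_string_def upt_rec numeral_eq_Suc)

text \<open>Relabelling acts on symbols and flipping on positions, so the two commute. This is the
  symmetry that reduces the base case to a deleted identity.\<close>

lemma string_flip:
  assumes "2 \<le> k" "k \<le> 4"
  shows "rel_string v (a \<circ> prefix_rev k) = list_flip k (rel_string v a)"
proof -
  have "k = 2 \<or> k = 3 \<or> k = 4"
    using assms by auto
  then show ?thesis
    by (auto simp: rel_string_def list_flip_def prefix_rev_def upt_rec numeral_eq_Suc)
qed

lemma list_flip_list_flip: "k \<le> length xs \<Longrightarrow> list_flip k (list_flip k xs) = xs"
  by (simp add: list_flip_def)

text \<open>Transports a checked table along the relabelling. The weight is symmetric because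
  passing to the flipped string exchanges the two summands of \<open>string_weight\<close>.\<close>

lemma table_weighting:
  assumes v: "inj v"
    and D: "perfect_table D t" "\<And>a. a \<in> coset 4 v \<Longrightarrow> a \<in> X \<longleftrightarrow> rel_string v a \<in> set D"
    and Y: "\<And>a k. a \<in> coset 4 v \<Longrightarrow> 2 \<le> k \<Longrightarrow> k \<le> 4 \<Longrightarrow> {a, a \<circ> prefix_rev k} \<in> Y \<Longrightarrow>
      string_weight t (rel_string v a) k = 0"
  shows "weighting 4 (coset 4 v) X Y (\<lambda>a k. string_weight t (rel_string v a) k / 2)"
proof -
  have sum: "string_weight t x 2 + string_weight t x 3 + string_weight t x 4 =
      (if x \<in> set D then 0 else 2)" if "x \<in> set strings4" for x
    using D(1) that unfolding perfect_table_def list_all_iff by blast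
  show ?thesis
  proof (rule weightingI)
    fix a and k :: nat assume ak: "a \<in> coset 4 v" "2 \<le> k" "k \<le> 4"
    have "length (rel_string v a) = 4"
      by (simp add: rel_string_def)
    then show "real (string_weight t (rel_string v (a \<circ> prefix_rev k)) k) / 2 =
        real (string_weight t (rel_string v a) k) / 2"
      using ak by (simp add: string_flip string_weight_def list_flip_list_flip)
    have "k = 2 \<or> k = 3 \<or> k = 4"
      using ak by auto
    then show "real (string_weight t (rel_string v a) k) / 2 = 0" if "a \<in> X"
      using sum[OF string_coset[OF v ak(1)]] D(2)[OF ak(1)] that by auto
  next
    fix a assume a: "a \<in> coset 4 v" "a \<notin> X"
    have "{2..4::nat} = {2, 3, 4}"
      by auto
    then have "(\<Sum>k=2..4. real (string_weight t (rel_string v a) k) / 2) = real (string_weight t (rel_string v a) 2 +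
        string_weight t (rel_string v a) 3 + string_weight t (rel_string v a) 4) / 2"
      by (simp add: add_divide_distrib)
    then show "(\<Sum>k=2..4. real (string_weight t (rel_string v a) k) / 2) = 1"
      using sum[OF string_coset[OF v a(1)]] D(2)[OF a(1)] a(2) by simp
  qed (use Y in auto)
qed

lemma robust_4:
  assumes p: "inj p"
  shows "robust 4 (coset 4 p)"
  unfolding robust_def
proof (intro allI impI)
  fix X Y
  assume X: "X \<subseteq> coset 4 p" and Y: "Y \<subseteq> flip_edges 4 (coset 4 p)" and card: "card X + card Y \<le> 4 - 2"
  have finX: "finite X" and finY: "finite Y"
    using X Y finite_coset finite_flip_edges finite_subset by metis+
  show "\<exists>w. weighting 4 (coset 4 p) X Y w"
  proof (cases "X = {}")
    case True
    then show ?thesis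
      using weighting_without_vertices[OF p finY, of 4] card by simp
  next
    case False
    then obtain v where vX: "v \<in> X" by blast
    then have "v \<in> coset 4 p"
      using X by blast
    then have v: "inj v" and C: "coset 4 p = coset 4 v"
      using p inj_coset coset_eq by metis+
    have string_v: "a = v" if "a \<in> coset 4 v" "rel_string v a = [1, 2, 3, 4]" for a
      using string_inject[OF v that(1) self_in_coset] string_self[OF v] that(2) by simp
    show ?thesis
    proof (cases "X = {v}")
      case True
      then have "card Y \<le> 1"
        using card by simp
      \<comment> \<open>If \<open>Y\<close> is empty, an arbitrary edge at \<open>v\<close> serves
        as the one to avoid, so that both cases are handled alike.\<close>
      then have "\<exists>c\<in>coset 4 v. \<exists>j\<in>{2..4}. Y \<subseteq> {{c, c \<circ> prefix_rev j}}"
        using Y self_in_coset[of v 4] finY unfolding C flip_edges_def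
        by (cases "card Y = 0") (auto simp: card_1_singleton_iff le_Suc_eq)
      then obtain c j where cj: "c \<in> coset 4 v" "j \<in> {2..4}" "Y \<subseteq> {{c, c \<circ> prefix_rev j}}"
        by blast
      then have "rel_string v c \<in> set strings4" "j = 2 \<or> j = 3 \<or> j = 4"
        using string_coset[OF v] by auto
      then obtain t where t: "t \<in> set edge_tables" "string_weight t (rel_string v c) j = 0"
        using edge_tables_avoid by (auto simp: list_all_iff list_ex_iff)
      have "weighting 4 (coset 4 v) X Y (\<lambda>a k. string_weight t (rel_string v a) k / 2)"
      proof (rule table_weighting[OF v])
        show "perfect_table [[1, 2, 3, 4]] t"
          using perfect_edge_tables t(1) by (simp add: list_all_iff)
        show "a \<in> X \<longleftrightarrow> rel_string v a \<in> set [[1, 2, 3, 4]]" if "a \<in> coset 4 v" for a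
          using string_v[OF that] string_self[OF v] True by auto
      next
        fix a and k :: nat
        assume ak: "a \<in> coset 4 v" "2 \<le> k" "k \<le> 4" "{a, a \<circ> prefix_rev k} \<in> Y"
        then have "{c, c \<circ> prefix_rev j} = {a, a \<circ> prefix_rev k}"
          using cj(3) by blast
        then have "k = j" and "a = c \<or> a = c \<circ> prefix_rev j"
          using flip_edge_eq[OF inj_coset[OF cj(1) v], of j k a] cj(2) ak(2) by auto
        moreover have "length (rel_string v c) = 4"
          by (simp add: rel_string_def)
        ultimately show "string_weight t (rel_string v a) k = 0"
          using t(2) cj(2) by (auto simp: string_flip string_weight_def list_flip_list_flip)
      qed
      then show ?thesis
        unfolding C by blast
    next
      case False
      then obtain u where u: "u \<in> X" "u \<noteq> v"
        using vX by blast
      \<comment> \<open>Two deleted vertices exhaust the budget of 2, so no edge is deleted.\<close>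
      then have "card {u, v} \<le> card X"
        using vX finX by (intro card_mono) auto
      then have "card X = card {u, v}" "card Y = 0"
        using card u(2) by auto
      then have "card X = card {u, v}" "Y = {}"
        using finY by simp_all
      then have Xuv: "X = {u, v}"
        using vX u(1) finX card_seteq[of X "{u, v}"] by auto
      have uC: "u \<in> coset 4 v"
        using u(1) X C by blast
      have "rel_string v u \<noteq> [1, 2, 3, 4]"
        using string_v[OF uC] u(2) by blast
      then have "rel_string v u \<in> set (tl strings4)"
        using string_coset[OF v uC] by (auto simp: strings4_def)
      then obtain t where t: "perfect_table [[1, 2, 3, 4], rel_string v u] t"
        using perfect_vertex_tables by (metis in_set_conv_nth list_all2_conv_all_nth)
      have "weighting 4 (coset 4 v) X Y (\<lambda>a k. string_weight t (rel_string v a) k / 2)"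
      proof (rule table_weighting[OF v t])
        show "a \<in> X \<longleftrightarrow> rel_string v a \<in> set [[1, 2, 3, 4], rel_string v u]" if "a \<in> coset 4 v" for a
          using string_v[OF that] string_self[OF v] string_inject[OF v that uC] Xuv by auto
      qed (use \<open>Y = {}\<close> in simp)
      then show ?thesis
        unfolding C by blast
    qed
  qed
qed

lemma robust_coset:
  assumes "4 \<le> n" "inj p"
  shows "robust n (coset n p)"
  using assms
proof (induction n arbitrary: p rule: nat_induct_at_least)
  case base
  then show ?case by (rule robust_4)
next
  case (Suc n)
  then show ?case by (intro robust_Suc) auto
qed

section \<open>Back to the pancake graph: the lower bound\<close>

lemma pancake_adj_iff:
  assumes "a permutes {1..n}" "b permutes {1..n}"
  shows "pancake_adj n a b \<longleftrightarrow> (\<exists>k\<in>{2..n}. b = a \<circ> prefix_rev k)"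
  unfolding pancake_adj_def
proof (rule bex_cong[OF refl])
  fix k assume k: "k \<in> {2..n}"
  show "(\<forall>i\<in>{1..k}. b i = a (k + 1 - i)) \<and> (\<forall>i\<in>{k+1..n}. b i = a i) \<longleftrightarrow> b = a \<circ> prefix_rev k"
  proof
    assume L: "(\<forall>i\<in>{1..k}. b i = a (k + 1 - i)) \<and> (\<forall>i\<in>{k+1..n}. b i = a i)"
    have "b i = a (prefix_rev k i)" for i
    proof -
      consider "i \<in> {1..k}" | "i \<in> {k+1..n}" | "i \<notin> {1..n}"
        by fastforce
      then show ?thesis
      proof cases
        \<comment> \<open>Adjacency compares entries on \<open>{1..n}\<close> only. Outside, both
          permutations and the reversal fix every point, which gives equality as functions.\<close>
        case 3
        then show ?thesis
          using assms k by (auto simp: permutes_not_in prefix_rev_def)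
      qed (use L in \<open>auto simp: prefix_rev_def\<close>)
    qed
    then show "b = a \<circ> prefix_rev k" by auto
  qed (auto simp: prefix_rev_def)
qed

lemma verts_pancake_graph: "verts (pancake_graph n) = coset n id"
  by (simp add: pancake_graph_def coset_def)

lemma edges_pancake_graph: "edges (pancake_graph n) = flip_edges n (coset n id)"
proof -
  have permutes: "a \<in> coset n id \<longleftrightarrow> a permutes {1..n}" for a
    by (simp add: coset_def)
  show ?thesis
  proof (intro equalityI subsetI)
    fix e assume "e \<in> edges (pancake_graph n)"
    then obtain a b where ab: "e = {a, b}" "a permutes {1..n}" "b permutes {1..n}" "pancake_adj n a b"
      unfolding pancake_graph_def by auto
    then obtain k where "k \<in> {2..n}" "b = a \<circ> prefix_rev k"
      using pancake_adj_iff by blast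
    then show "e \<in> flip_edges n (coset n id)"
      using ab(1,2) unfolding flip_edges_def permutes by blast
  next
    fix e assume "e \<in> flip_edges n (coset n id)"
    then obtain a k where ak: "a permutes {1..n}" "k \<in> {2..n}" "e = {a, a \<circ> prefix_rev k}"
      unfolding flip_edges_def permutes by blast
    then have "a \<circ> prefix_rev k permutes {1..n}"
      using coset_flip[of a n id k] by (simp add: permutes)
    moreover from this have "pancake_adj n a (a \<circ> prefix_rev k)"
      using pancake_adj_iff[OF ak(1)] ak(2) by blast
    ultimately show "e \<in> edges (pancake_graph n)"
      using ak(1,3) unfolding pancake_graph_def by auto
  qed
qed

lemma fractional_perfect_matching_of_weighting:
  assumes F: "X = {v. Inl v \<in> F}" "Y = {e. Inr e \<in> F}"
    and w: "weighting n (coset n id) X Y w"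
  shows "\<exists>g. fractional_perfect_matching (delete (pancake_graph n) F) g"
proof -
  let ?C = "coset n id" and ?G = "delete (pancake_graph n) F"
  \<comment> \<open>The description is unambiguous: an edge determines its length, and the symmetry
    of \<open>w\<close> makes both ends give the same value.\<close>
  define g where "g e = (THE r. \<exists>a\<in>?C. \<exists>k\<in>{2..n}. e = {a, a \<circ> prefix_rev k} \<and> r = w a k)" for e
  have inj: "inj a" if "a \<in> ?C" for a
    using inj_coset[OF that] by simp
  have g: "g {a, a \<circ> prefix_rev k} = w a k" if ak: "a \<in> ?C" "k \<in> {2..n}" for a k
    unfolding g_def
  proof (rule the_equality)
    fix r assume "\<exists>b\<in>?C. \<exists>j\<in>{2..n}. {a, a \<circ> prefix_rev k} = {b, b \<circ> prefix_rev j} \<and> r = w b j"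
    then obtain b j where bj: "b \<in> ?C" "j \<in> {2..n}" "{a, a \<circ> prefix_rev k} = {b, b \<circ> prefix_rev j}" "r = w b j"
      by blast
    then have "k = j" "b = a \<or> b = a \<circ> prefix_rev j"
      using flip_edge_eq[OF inj[OF ak(1)] _ _ bj(3)] ak(2) by auto
    then show "r = w a k"
      using weightingD(2)[OF w ak(1), of k] ak(2) bj(4) by auto
  next
    show "\<exists>b\<in>?C. \<exists>j\<in>{2..n}. {a, a \<circ> prefix_rev k} = {b, b \<circ> prefix_rev j} \<and> w a k = w b j"
      using ak by blast
  qed
  have verts: "verts ?G = ?C - X"
    by (auto simp: delete_def verts_pancake_graph F)
  have edges: "edges ?G = {e \<in> flip_edges n ?C. e \<notin> Y \<and> e \<inter> X = {}}"
    by (auto simp: delete_def edges_pancake_graph F)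
  have sum: "(\<Sum>e | e \<in> edges ?G \<and> a \<in> e. g e) = 1" if a: "a \<in> ?C - X" for a
  proof -
    let ?e = "\<lambda>k. {a, a \<circ> prefix_rev k}"
    have "inj_on ?e {2..n}"
    proof (rule inj_onI)
      fix j k assume jk: "j \<in> {2..n}" "k \<in> {2..n}" "?e j = ?e k"
      then show "j = k"
        using flip_edge_eq[OF inj _ _ jk(3)] a by auto
    qed
    then have "(\<Sum>e\<in>?e ` {2..n}. g e) = (\<Sum>k=2..n. g (?e k))"
      by (rule sum.reindex_cong) auto
    also have "\<dots> = (\<Sum>k=2..n. w a k)"
      using g a by (intro sum.cong) auto
    also have "\<dots> = 1"
      using weightingD(5)[OF w, of a] a by simp
    finally have total: "(\<Sum>e\<in>?e ` {2..n}. g e) = 1" .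
    \<comment> \<open>A deleted edge at \<open>a\<close>, or one leading to a deleted vertex, has
      weight 0, so the sum may run over all lengths.\<close>
    have "(\<Sum>e | e \<in> edges ?G \<and> a \<in> e. g e) = (\<Sum>e\<in>?e ` {2..n}. g e)"
    proof (rule sum.mono_neutral_left)
      show "{e. e \<in> edges ?G \<and> a \<in> e} \<subseteq> ?e ` {2..n}"
      proof
        fix e assume "e \<in> {e. e \<in> edges ?G \<and> a \<in> e}"
        then obtain b k where bk: "k \<in> {2..n}" "e = {b, b \<circ> prefix_rev k}" "a \<in> e"
          unfolding edges flip_edges_def by blast
        then have "e = ?e k"
          by auto
        then show "e \<in> ?e ` {2..n}"
          using bk(1) by blast
      qed
      show "\<forall>e\<in>?e ` {2..n} - {e. e \<in> edges ?G \<and> a \<in> e}. g e = 0"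
      proof
        fix e assume e: "e \<in> ?e ` {2..n} - {e. e \<in> edges ?G \<and> a \<in> e}"
        then obtain k where k: "k \<in> {2..n}" "e = ?e k"
          by blast
        then have "?e k \<in> flip_edges n ?C"
          using a unfolding flip_edges_def by blast
        then have "?e k \<in> Y \<or> a \<circ> prefix_rev k \<in> X"
          using e a k unfolding edges by auto
        then have "w a k = 0"
        proof
          assume "a \<circ> prefix_rev k \<in> X"
          then have "w (a \<circ> prefix_rev k) k = 0"
            using weightingD(3)[OF w coset_flip[of a n id k], of k] a k by simp
          then show ?thesis
            using weightingD(2)[OF w, of a k] a k by simp
        qed (use weightingD(4)[OF w, of a k] a k in simp)
        then show "g e = 0"
          using g[of a k] a k by simp
      qed
    qed simp
    then show ?thesis
      using total by simp
  qed
  have nonneg: "0 \<le> g e" if "e \<in> edges ?G" for e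
    using that g weightingD(1)[OF w] unfolding edges flip_edges_def by auto
  \<comment> \<open>Weightings impose no upper bound. It follows from the sum at an end of
    \<open>e\<close>, whose terms are nonnegative and add up to 1.\<close>
  have "g e \<le> 1" if e: "e \<in> edges ?G" for e
  proof -
    obtain a where a: "a \<in> ?C - X" "a \<in> e"
      using e unfolding edges flip_edges_def by blast
    have "finite (edges ?G)"
      unfolding edges using finite_flip_edges[OF finite_coset] by simp
    then have "g e \<le> (\<Sum>e | e \<in> edges ?G \<and> a \<in> e. g e)"
      using e a nonneg by (intro member_le_sum) auto
    then show ?thesis
      using sum[OF a(1)] by simp
  qed
  then have "fractional_perfect_matching ?G g"
    unfolding fractional_perfect_matching_def verts using nonneg sum by blast
  then show ?thesis by blast
qed

text \<open>The lower bound for both parameters, as a set of edges is a special fault set. The parts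
  of \<open>F\<close> in the disjoint union are the sets \<open>X\<close> and \<open>Y\<close> to
  which \<open>robust_coset\<close> applies.\<close>

lemma card_fault_set:
  assumes n: "4 \<le> n" and F: "F \<subseteq> verts (pancake_graph n) <+> edges (pancake_graph n)"
    and no: "\<nexists>g. fractional_perfect_matching (delete (pancake_graph n) F) g"
  shows "n - 1 \<le> card F"
proof (rule ccontr)
  assume small: "\<not> n - 1 \<le> card F"
  define X where "X = {v. Inl v \<in> F}"
  define Y where "Y = {e. Inr e \<in> F}"
  have X: "X \<subseteq> coset n id" and Y: "Y \<subseteq> flip_edges n (coset n id)"
    using F unfolding X_def Y_def verts_pancake_graph edges_pancake_graph by blast+
  have "finite X" "finite Y"
    using X Y finite_coset finite_flip_edges finite_subset by metis+
  moreover have "F = X <+> Y"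
    unfolding X_def Y_def by (intro set_eqI; case_tac x) auto
  ultimately have "card X + card Y \<le> n - 2"
    using small by (simp add: card_Plus)
  then obtain w where "weighting n (coset n id) X Y w"
    using robust_coset[OF n inj_on_id] X Y unfolding robust_def by blast
  then show False
    using fractional_perfect_matching_of_weighting[OF X_def Y_def] no by blast
qed

section \<open>The upper bound and the conclusion\<close>

lemma isolated_vertex:
  assumes "v \<in> verts G" "{e \<in> edges G. v \<in> e} = {}"
  shows "\<not> fractional_perfect_matching G g"
proof
  assume "fractional_perfect_matching G g"
  then have "(\<Sum>e | e \<in> edges G \<and> v \<in> e. g e) = 1"
    using assms(1) by (simp add: fractional_perfect_matching_def)
  then show False
    unfolding assms(2) by simp
qed

lemma isolating_edges:
  obtains F where "F \<subseteq> edges (pancake_graph n)" "card F = n - 1"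
    "\<nexists>g. fractional_perfect_matching (delete (pancake_graph n) (Inr ` F)) g"
proof
  let ?e = "\<lambda>k. {id, prefix_rev k}"
  let ?F = "?e ` {2..n}"
  have id: "id \<in> coset n id"
    by (rule self_in_coset)
  show "?F \<subseteq> edges (pancake_graph n)"
    unfolding edges_pancake_graph flip_edges_def using id by force
  have "inj_on ?e {2..n}"
  proof (rule inj_onI)
    fix j k assume "j \<in> {2..n}" "k \<in> {2..n}" "?e j = ?e k"
    then show "j = k"
      using flip_edge_eq[of id j k id] by simp
  qed
  then show "card ?F = n - 1"
    by (simp add: card_image)
  \<comment> \<open>An edge at \<open>id\<close> may be presented from its other end; then that end
    is \<open>prefix_rev k\<close>, since reversals are involutions.\<close>
  have "e \<in> ?F" if "e \<in> edges (pancake_graph n)" "id \<in> e" for e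
  proof -
    obtain a k where ak: "k \<in> {2..n}" "e = {a, a \<circ> prefix_rev k}"
      using \<open>e \<in> edges (pancake_graph n)\<close> unfolding edges_pancake_graph flip_edges_def by blast
    then consider "a = id" | "a \<circ> prefix_rev k = id"
      using \<open>id \<in> e\<close> by auto
    then have "e = ?e k"
    proof cases
      case 1
      then show ?thesis using ak(2) by simp
    next
      case 2
      then have "a = prefix_rev k"
        by (metis comp_prefix_rev_cancel id_comp)
      then show ?thesis using 2 ak(2) by auto
    qed
    then show ?thesis
      using ak(1) by blast
  qed
  then have isolated: "{e \<in> edges (delete (pancake_graph n) (Inr ` ?F)). id \<in> e} = {}"
    by (auto simp: delete_def)
  have "id \<in> verts (delete (pancake_graph n) (Inr ` ?F))"
    using id by (auto simp: delete_def verts_pancake_graph)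
  then show "\<nexists>g. fractional_perfect_matching (delete (pancake_graph n) (Inr ` ?F)) g"
    using isolated_vertex[OF _ isolated] by simp
qed

theorem theorem4p36:
  fixes n :: nat
  assumes "n \<ge> 4"
  shows "fsmp (pancake_graph n) = n - 1 \<and> fmp (pancake_graph n) = n - 1"
proof
  obtain F where F: "F \<subseteq> edges (pancake_graph n)" "card F = n - 1"
    "\<nexists>g. fractional_perfect_matching (delete (pancake_graph n) (Inr ` F)) g"
    by (rule isolating_edges)
  \<comment> \<open>The same edge set, placed in the disjoint union, attains the minimum for
    \<open>fsmp\<close>.\<close>
  have F': "Inr ` F \<subseteq> verts (pancake_graph n) <+> edges (pancake_graph n)" "card (Inr ` F) = n - 1"
    using F by (auto simp: card_image)
  show "fsmp (pancake_graph n) = n - 1"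
    unfolding fsmp_def
  proof (rule cInf_eq_minimum)
    show "n - 1 \<in> {card F |F. F \<subseteq> verts (pancake_graph n) <+> edges (pancake_graph n) \<and>
        (\<nexists>g. fractional_perfect_matching (delete (pancake_graph n) F) g)}"
      using F' F(3) by (intro CollectI exI[of _ "Inr ` F"] conjI) (rule sym)
  qed (use card_fault_set[OF assms] in blast)
  show "fmp (pancake_graph n) = n - 1"
    unfolding fmp_def
  proof (rule cInf_eq_minimum)
    show "n - 1 \<in> {card F |F. F \<subseteq> edges (pancake_graph n) \<and>
        (\<nexists>g. fractional_perfect_matching (delete (pancake_graph n) (Inr ` F)) g)}"
      using F by (intro CollectI exI[of _ F] conjI) (rule sym)
  next
    fix m assume "m \<in> {card F |F. F \<subseteq> edges (pancake_graph n) \<and>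
        (\<nexists>g. fractional_perfect_matching (delete (pancake_graph n) (Inr ` F)) g)}"
    then obtain H where H: "H \<subseteq> edges (pancake_graph n)" "m = card H"
      "\<nexists>g. fractional_perfect_matching (delete (pancake_graph n) (Inr ` H)) g"
      by blast
    then show "n - 1 \<le> m"
      using card_fault_set[OF assms, of "Inr ` H"] by (auto simp: card_image)
  qed
qed

end
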